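(* Let $n\ge1$ be a natural number and let $\mu$ be a finite measure on $\mathcal{T}=[0,1]$ with $\mu(\mathcal{T})>0$. Every sequential best-response dynamic in the producer game with fine preferences $(n,\mu,\succeq_F)$ reaches a Nash equilibrium of $(n,\mu,\succeq_F)$ (from step $0$) in at most $n$ rounds, and never visits a nonequilibrium after that point.
   Context: Notation: $\mathcal{T}=[0,1]$ (with the Borel $\sigma$-algebra), $\mathbb{P}_n=\{0,1,\ldots,n-1\}$, and $(\bar t_{-j},t')$ denotes $\bar t$ with its $j$-th coordinate replaced by $t'$. Consumer game $(\mu;\bar t)$, for $\bar t=(t_0,\ldots,t_{n-1})\in\mathcal{T}^{\mathbb{P}_n}$. Consumers of types $d\in\mathcal{T}$ are distributed according to $\mu$. The strategies of type $d$ are $S_d=\{j\in\mathbb{P}_n\mid t_j\le d\}\cup\{\lnot\}$ ($\lnot$ means "not consuming"); $S=\mathbb{P}_n\cup\{\lnot\}$. A mixed-consumption profile is a measurable $s:\mathcal{T}\to[0,1]^S$ such that, for every $d$, $s(d)$ is a probability vector on $S$ supported in $S_d$; its loads are $\ell^s_j=\int_{\mathcal{T}}s_j\,d\mu$. It is a Nash equilibrium if for every $d\in\mathcal{T}$: $\lnot\in\operatorname{supp}(s(d))$ only if $S_d=\{\lnot\}$, and $\ell^s_k\le\ell^s_j$ for all $k\in\operatorname{supp}(s(d))$, $j\in S_d\setminus\{\lnot\}$. Such equilibria exist and all have the same producer loads; $\ell_j(\bar t)$ denotes the load $\ell^s_j$ of producer $j\in\mathbb{P}_n$ in any such equilibrium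 $s$. Producer game with fine preferences $(n,\mu,\succeq_F)$: the players are the producers $\mathbb{P}_n$, each with pure-strategy set $\mathcal{T}$. Producer $j$ strictly prefers profile $\bar t$ to profile $\bar t'$ iff $\ell_j(\bar t)>\ell_j(\bar t')$, or $\ell_j(\bar t)=\ell_j(\bar t')$ and $t_j>t'_j$. A schedule is a sequence $(P_i)_{i=0}^\infty$ of nonempty subsets of $\mathbb{P}_n$ such that every $j\in\mathbb{P}_n$ belongs to infinitely many $P_i$; it is sequential if $|P_i|=1$ for all $i$. A best-response dynamic is a sequence $(\bar t^i,P_i)_{i=0}^\infty$, with $(P_i)$ a schedule and $\bar t^i\in\mathcal{T}^{\mathbb{P}_n}$, such that for every $i$: for $j\in P_i$, $t^{i+1}_j$ is a best response of $j$ to $\bar t^i_{-j}$ (with respect to fine preferences); for $j\notin P_i$, $t^{i+1}_j=t^i_j$. It is sequential if its schedule is. A set of consecutive indices $\{i_1,i_1+1,\ldots,i_2\}$ is a round if $\bigcup_{i=i_1}^{i_2}P_i=\mathbb{P}_n$. For $i_1\le i_2$, $i_2$ is said to be reached from $i_1$ in $r$ rounds if $r-1$ is the largest number of pairwise-disjoint rounds contained in $\{i_1,i_1+1,\ldots,i_2-2\}$ (this set being empty if $i_2\le i_1+1$). *)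

theory Defs
  imports "HOL-Analysis.Analysis"
begin

type_synonym profile = "nat \<Rightarrow> real"

text \<open>A pure consumer choice is a \<^typ>\<open>nat option\<close>: \<^term>\<open>Some j\<close> means consuming from producer
  \<^term>\<open>j\<close>, and \<^term>\<open>None\<close> means not consuming.\<close>

type_synonym mixed_consumption = "real \<Rightarrow> nat option \<Rightarrow> real"

definition types :: "real set" where
  "types = {0..1}"

definition profiles :: "nat \<Rightarrow> profile set" where
  "profiles n = {..<n} \<rightarrow>\<^sub>E types"

definition choices :: "nat \<Rightarrow> nat option set" where
  "choices n = insert None (Some ` {..<n})"

definition consumer_strategies :: "nat \<Rightarrow> profile \<Rightarrow> real \<Rightarrow> nat option set" where
  "consumer_strategies n t d = insert None (Some ` {j. j < n \<and> t j \<le> d})"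

definition mixed_supp :: "nat \<Rightarrow> (nat option \<Rightarrow> real) \<Rightarrow> nat option set" where
  "mixed_supp n p = {k \<in> choices n. p k \<noteq> 0}"

definition mixed_consumption_profile ::
    "nat \<Rightarrow> real measure \<Rightarrow> profile \<Rightarrow> mixed_consumption \<Rightarrow> bool" where
  "mixed_consumption_profile n \<mu> t s \<longleftrightarrow>
     s \<in> measurable \<mu> (Pi\<^sub>M (choices n) (\<lambda>_. restrict_space borel {0..1})) \<and>
     (\<forall>d\<in>types. (\<forall>k\<in>choices n. 0 \<le> s d k) \<and> (\<Sum>k\<in>choices n. s d k) = 1 \<and>
        mixed_supp n (s d) \<subseteq> consumer_strategies n t d)"

definition consumer_load :: "real measure \<Rightarrow> mixed_consumption \<Rightarrow> nat option \<Rightarrow> real" where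
  "consumer_load \<mu> s k = (LINT d|\<mu>. s d k)"

definition consumer_equilibrium ::
    "nat \<Rightarrow> real measure \<Rightarrow> profile \<Rightarrow> mixed_consumption \<Rightarrow> bool" where
  "consumer_equilibrium n \<mu> t s \<longleftrightarrow>
     mixed_consumption_profile n \<mu> t s \<and>
     (\<forall>d\<in>types.
        (None \<in> mixed_supp n (s d) \<longrightarrow> consumer_strategies n t d = {None}) \<and>
        (\<forall>k\<in>mixed_supp n (s d). \<forall>j\<in>consumer_strategies n t d - {None}.
           consumer_load \<mu> s k \<le> consumer_load \<mu> s j))"

text \<open>The load of a producer is the same in every consumer equilibrium, and an equilibrium
  exists; the description operator below refers to this common value.\<close>

definition producer_load :: "nat \<Rightarrow> real measure \<Rightarrow> profile \<Rightarrow> nat \<Rightarrow> real" where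
  "producer_load n \<mu> t j =
     (THE x. \<exists>s. consumer_equilibrium n \<mu> t s \<and> x = consumer_load \<mu> s (Some j))"

definition fine_prefers :: "nat \<Rightarrow> real measure \<Rightarrow> nat \<Rightarrow> profile \<Rightarrow> profile \<Rightarrow> bool" where
  "fine_prefers n \<mu> j t t' \<longleftrightarrow>
     producer_load n \<mu> t j > producer_load n \<mu> t' j \<or>
     producer_load n \<mu> t j = producer_load n \<mu> t' j \<and> t j > t' j"

definition fine_best_response :: "nat \<Rightarrow> real measure \<Rightarrow> nat \<Rightarrow> profile \<Rightarrow> real \<Rightarrow> bool" where
  "fine_best_response n \<mu> j t x \<longleftrightarrow>
     x \<in> types \<and> (\<forall>y\<in>types. \<not> fine_prefers n \<mu> j (t(j := y)) (t(j := x)))"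

definition fine_nash_equilibrium :: "nat \<Rightarrow> real measure \<Rightarrow> profile \<Rightarrow> bool" where
  "fine_nash_equilibrium n \<mu> t \<longleftrightarrow>
     t \<in> profiles n \<and> (\<forall>j<n. fine_best_response n \<mu> j t (t j))"

definition schedule :: "nat \<Rightarrow> (nat \<Rightarrow> nat set) \<Rightarrow> bool" where
  "schedule n P \<longleftrightarrow>
     (\<forall>i. P i \<noteq> {} \<and> P i \<subseteq> {..<n}) \<and> (\<forall>j<n. infinite {i. j \<in> P i})"

definition sequential :: "(nat \<Rightarrow> nat set) \<Rightarrow> bool" where
  "sequential P \<longleftrightarrow> (\<forall>i. card (P i) = 1)"

definition best_response_dynamic ::
    "nat \<Rightarrow> real measure \<Rightarrow> (nat \<Rightarrow> profile) \<Rightarrow> (nat \<Rightarrow> nat set) \<Rightarrow> bool" where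
  "best_response_dynamic n \<mu> t P \<longleftrightarrow>
     schedule n P \<and> (\<forall>i. t i \<in> profiles n) \<and>
     (\<forall>i. (\<forall>j\<in>P i. fine_best_response n \<mu> j (t i) (t (Suc i) j)) \<and>
          (\<forall>j\<in>{..<n} - P i. t (Suc i) j = t i j))"

definition is_round :: "nat \<Rightarrow> (nat \<Rightarrow> nat set) \<Rightarrow> nat set \<Rightarrow> bool" where
  "is_round n P R \<longleftrightarrow> (\<exists>a b. a \<le> b \<and> R = {a..b}) \<and> (\<Union>i\<in>R. P i) = {..<n}"

text \<open>The condition \<open>i + 2 \<le> i\<^sub>2\<close> stands for \<open>i \<le> i\<^sub>2 - 2\<close>, avoiding truncated subtraction when
  \<open>i\<^sub>2 < 2\<close>.\<close>

definition disjoint_rounds ::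
    "nat \<Rightarrow> (nat \<Rightarrow> nat set) \<Rightarrow> nat \<Rightarrow> nat \<Rightarrow> nat set set \<Rightarrow> bool" where
  "disjoint_rounds n P i\<^sub>1 i\<^sub>2 F \<longleftrightarrow>
     disjoint F \<and> (\<forall>R\<in>F. is_round n P R \<and> R \<subseteq> {i. i\<^sub>1 \<le> i \<and> i + 2 \<le> i\<^sub>2})"

definition reached_in_rounds :: "nat \<Rightarrow> (nat \<Rightarrow> nat set) \<Rightarrow> nat \<Rightarrow> nat \<Rightarrow> nat \<Rightarrow> bool" where
  "reached_in_rounds n P i\<^sub>1 i\<^sub>2 r \<longleftrightarrow>
     i\<^sub>1 \<le> i\<^sub>2 \<and> r = 1 + Max (card ` {F. disjoint_rounds n P i\<^sub>1 i\<^sub>2 F})"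

end

theory Submission
  imports Defs
begin

text \<open>Let \<open>\<lambda> = \<mu>(\<T>) / n\<close> be the fair load and say that level \<open>k\<close> is filled when more than \<open>k\<close>
  producers \<open>j\<close> satisfy \<open>\<mu>([0, t\<^sub>j)) \<le> k \<lambda>\<close>. When all levels \<open>k < n\<close> are filled, every load equals
  \<open>\<lambda>\<close>. A best response always earns at least \<open>\<lambda>\<close>, and this forces a move to preserve filled
  levels: if all levels above \<open>m\<close> are filled, a mover that settles above level \<open>m\<close> can earn \<open>\<lambda>\<close>
  only if level \<open>m\<close> is filled as well. So each round fills one more level, from the top
  downwards, and after \<open>n - 1\<close> rounds only level \<open>0\<close> is missing, which the next move fills. From
  then on each mover takes the highest position that keeps all levels filled, and never
  moves again; one more round brings everybody to rest.\<close>

section \<open>Balanced allocation of weighted groups\<close>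

text \<open>A minimiser of the sum of squared loads is balanced on every group of positive weight; groups
  of weight \<open>0\<close> do not affect the loads and are redirected to their least loaded member.\<close>

lemma balanced_allocation:
  fixes w :: "'a set \<Rightarrow> real" and G :: "'a set set" and J :: "'a set"
  assumes "finite J" "G \<subseteq> Pow J" "{} \<notin> G" and w: "\<And>X. X \<in> G \<Longrightarrow> 0 \<le> w X"
  obtains a :: "'a set \<Rightarrow> 'a \<Rightarrow> real"
  where "\<And>X j. a X j \<in> {0..1}" "\<And>X. X \<in> G \<Longrightarrow> (\<Sum>j\<in>X. a X j) = 1" "\<And>X j. j \<notin> X \<Longrightarrow> a X j = 0"
    "\<And>X j k. X \<in> G \<Longrightarrow> j \<in> X \<Longrightarrow> k \<in> X \<Longrightarrow> a X k \<noteq> 0 \<Longrightarrow>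
       (\<Sum>Y\<in>G. w Y * a Y k) \<le> (\<Sum>Y\<in>G. w Y * a Y j)"
proof -
  have finG: "finite G" using assms by (meson finite_Pow_iff finite_subset)
  have finX: "finite X" if "X \<in> G" for X using assms that by (meson PowD finite_subset subsetD)
  \<comment> \<open>Allocations are taken as functions on pairs, so that the product topology makes
    \<open>K\<close> compact and \<open>\<Phi>\<close> attains its minimum on it.\<close>
  define K where "K = {a :: 'a set \<times> 'a \<Rightarrow> real. (\<forall>p. a p \<in> {0..1}) \<and>
      (\<forall>X\<in>G. (\<Sum>j\<in>X. a (X, j)) = 1) \<and> (\<forall>X j. j \<notin> X \<longrightarrow> a (X, j) = 0)}"
  define l where "l a j = (\<Sum>Y\<in>G. w Y * a (Y, j))" for a :: "'a set \<times> 'a \<Rightarrow> real" and j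
  define \<Phi> where "\<Phi> a = (\<Sum>j\<in>J. (l a j)\<^sup>2)" for a
  have "compact (Pi UNIV (\<lambda>_. {0..1}) :: ('a set \<times> 'a \<Rightarrow> real) set)"
    using compactin_PiE[of "\<lambda>_. euclidean" UNIV "\<lambda>_. {0..1::real}"]
    by (simp add: euclidean_product_topology PiE_def)
  moreover have "closed {a :: 'a set \<times> 'a \<Rightarrow> real. \<forall>X\<in>G. (\<Sum>j\<in>X. a (X, j)) = 1}"
    unfolding Ball_def by (intro closed_Collect_all closed_Collect_imp closed_Collect_eq continuous_intros) auto
  moreover have "closed {a :: 'a set \<times> 'a \<Rightarrow> real. \<forall>X j. j \<notin> X \<longrightarrow> a (X, j) = 0}"
    by (intro closed_Collect_all closed_Collect_imp closed_Collect_eq continuous_intros) auto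
  moreover have "K = Pi UNIV (\<lambda>_. {0..1}) \<inter> ({a. \<forall>X\<in>G. (\<Sum>j\<in>X. a (X, j)) = 1} \<inter>
      {a. \<forall>X j. j \<notin> X \<longrightarrow> a (X, j) = 0})"
    by (auto simp: K_def Pi_iff)
  ultimately have "compact K" by (simp add: compact_Int_closed closed_Int)
  moreover have "K \<noteq> {}"
  proof -
    have "(\<lambda>(X, j). if X \<in> G \<and> j = (SOME j. j \<in> X) then 1 else 0) \<in> K"
      using assms(3) finX by (auto simp: K_def some_in_eq)
    then show ?thesis by blast
  qed
  moreover have "continuous_on K \<Phi>"
    unfolding \<Phi>_def l_def by (intro continuous_intros continuous_on_subset[OF continuous_on_product_coordinates]) auto
  ultimately obtain a where aK: "a \<in> K" and amin: "\<And>b. b \<in> K \<Longrightarrow> \<Phi> a \<le> \<Phi> b"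
    using continuous_attains_inf by metis
  have bal: "l a k \<le> l a j" if X: "X \<in> G" "w X > 0" "j \<in> X" "k \<in> X" "a (X, k) \<noteq> 0" for X j k
  proof (rule ccontr)
    assume "\<not> ?thesis"
    then have lt: "l a j < l a k" by simp
    then have jk: "j \<noteq> k" by auto
    \<comment> \<open>The share of \<open>X\<close> moved from \<open>k\<close> to \<open>j\<close>:
      no more than \<open>k\<close> has, and after weighting at most half the load gap.\<close>
    define e where "e = min (a (X, k)) ((l a k - l a j) / (2 * w X))"
    have apos: "a (X, k) > 0" using aK X(5) by (auto simp: K_def less_le)
    have e: "0 < e" "e \<le> a (X, k)" using apos lt X by (auto simp: e_def)
    have "e \<le> (l a k - l a j) / (2 * w X)" by (simp add: e_def)
    then have e2: "e * w X * 2 \<le> l a k - l a j" using X by (simp add: field_simps)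
    define b where "b = a((X, k) := a (X, k) - e, (X, j) := a (X, j) + e)"
    have "a (X, j) + a (X, k) \<le> (\<Sum>i\<in>X. a (X, i))"
      using sum_mono2[of X "{j, k}" "\<lambda>i. a (X, i)"] X finX jk aK by (auto simp: K_def)
    then have aj: "a (X, j) + a (X, k) \<le> 1" using aK X by (simp add: K_def)
    have "(\<Sum>i\<in>X. b (X, i)) = 1"
    proof -
      have "(\<Sum>i\<in>X. b (X, i)) = (\<Sum>i\<in>X. a (X, i) + (if i = j then e else 0) - (if i = k then e else 0))"
        by (rule sum.cong) (use jk in \<open>auto simp: b_def\<close>)
      also have "\<dots> = (\<Sum>i\<in>X. a (X, i))"
        using X finX by (simp add: sum_subtractf sum.distrib)
      finally show ?thesis using aK X by (simp add: K_def)
    qed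
    moreover have "(\<Sum>i\<in>Y. b (Y, i)) = 1" if "Y \<in> G" "Y \<noteq> X" for Y
      using that aK by (simp add: K_def b_def)
    moreover have "b p \<in> {0..1}" for p
    proof -
      have "a q \<in> {0..1}" for q using aK by (cases q) (auto simp: K_def)
      from this[of p] this[of "(X, j)"] this[of "(X, k)"]
      have "a p \<in> {0..1}" "0 \<le> a (X, j)" "a (X, k) \<le> 1" by auto
      then show ?thesis using e aj apos by (auto simp: b_def)
    qed
    moreover have "\<forall>Y i. i \<notin> Y \<longrightarrow> b (Y, i) = 0" using aK X by (auto simp: K_def b_def)
    ultimately have "b \<in> K" by (auto simp: K_def)
    have lb: "l b i = l a i + (if i = j then e * w X else 0) - (if i = k then e * w X else 0)" for i
    proof -
      have "l b i = (\<Sum>Y\<in>G. w Y * a (Y, i) + (if Y = X then w X * (b (X, i) - a (X, i)) else 0))"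
        unfolding l_def by (rule sum.cong) (auto simp: b_def algebra_simps)
      also have "\<dots> = l a i + w X * (b (X, i) - a (X, i))"
        using X finG by (simp add: sum.distrib l_def)
      finally show ?thesis using jk by (auto simp: b_def)
    qed
    have "\<Phi> b - \<Phi> a = (\<Sum>i\<in>J. (l b i)\<^sup>2 - (l a i)\<^sup>2)" by (simp add: \<Phi>_def sum_subtractf)
    also have "\<dots> = (\<Sum>i\<in>{j, k}. (l b i)\<^sup>2 - (l a i)\<^sup>2)"
      by (rule sum.mono_neutral_right) (use assms X lb in auto)
    \<comment> \<open>With \<open>h = e * w X\<close> this is \<open>2 * h * (h - gap)\<close>,
      negative since \<open>0 < h\<close> and \<open>h \<le> gap / 2\<close>.\<close>
    also have "\<dots> = 2 * (e * w X) * (e * w X - (l a k - l a j))"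
      using jk by (simp add: lb power2_eq_square algebra_simps)
    also have "\<dots> < 0"
    proof -
      have p: "0 < e * w X" using e X by simp
      then have "e * w X - (l a k - l a j) < 0" using e2 by linarith
      then show ?thesis using p by (simp add: mult_less_0_iff)
    qed
    finally show False using amin[OF \<open>b \<in> K\<close>] by simp
  qed
  define f where "f X = (ARG_MIN (l a) j. j \<in> X)" for X
  have f: "f X \<in> X" "\<And>j. j \<in> X \<Longrightarrow> l a (f X) \<le> l a j" if "X \<in> G" for X
    using arg_min_if_finite[of X "l a"] finX[OF that] assms(3) that
    unfolding f_def arg_min_on_def[symmetric] by (auto simp: not_less)
  define c where "c X j = (if X \<in> G \<and> w X = 0 then (if j = f X then 1 else 0) else a (X, j))" for X j
  have l: "(\<Sum>Y\<in>G. w Y * c Y j) = l a j" for j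
    unfolding l_def by (rule sum.cong) (auto simp: c_def)
  show ?thesis
  proof (rule that[of c])
    show "c X j \<in> {0..1}" for X j using aK by (auto simp: c_def K_def)
    show "(\<Sum>j\<in>X. c X j) = 1" if "X \<in> G" for X
      using aK that f finX by (cases "w X = 0") (auto simp: c_def K_def)
    show "c X j = 0" if "j \<notin> X" for X j using aK that f by (auto simp: c_def K_def)
    show "(\<Sum>Y\<in>G. w Y * c Y k) \<le> (\<Sum>Y\<in>G. w Y * c Y j)"
      if "X \<in> G" "j \<in> X" "k \<in> X" "c X k \<noteq> 0" for X j k
      unfolding l using that bal[of X j k] f(2) w[of X] by (cases "w X = 0") (auto simp: c_def split: if_splits)
  qed
qed

section \<open>Mass, positions and available producers\<close>

locale market = finite_measure \<mu> for \<mu> :: "real measure" +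
  fixes n :: nat
  assumes n_pos: "n \<ge> 1"
    and sets_mu: "sets \<mu> = sets (restrict_space borel types)"
    and mass_pos: "measure \<mu> types > 0"
begin

definition mass :: real where "mass = measure \<mu> types"

text \<open>The left-continuous distribution function of \<open>\<mu>\<close>: a producer at
  \<open>x\<close> still serves type \<open>x\<close>, so the strict inequality gives exactly the
  mass out of its reach.\<close>

definition below :: "real \<Rightarrow> real" where "below x = measure \<mu> {d \<in> types. d < x}"

definition fair :: real where "fair = mass / real n"

abbreviation load :: "profile \<Rightarrow> nat \<Rightarrow> real" where "load \<equiv> producer_load n \<mu>"

definition avail :: "profile \<Rightarrow> real \<Rightarrow> nat set" where "avail t d = {j. j < n \<and> t j \<le> d}"

lemma space_mu: "space \<mu> = types"
  using sets_eq_imp_space_eq[OF sets_mu] by (simp add: space_restrict_space)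

lemma n_fair: "real n * fair = mass"
  using n_pos by (simp add: fair_def)

lemma fair_pos: "fair > 0"
  using n_pos mass_pos by (simp add: fair_def mass_def)

lemma measurable_mu_borel: "f \<in> borel_measurable borel \<Longrightarrow> f \<in> borel_measurable \<mu>"
  unfolding measurable_cong_sets[OF sets_mu refl] by (rule measurable_restrict_space1)

lemma sets_less [measurable]: "{d \<in> types. d < x} \<in> sets \<mu>"
  and sets_ge [measurable]: "{d \<in> types. x \<le> d} \<in> sets \<mu>"
proof -
  have [measurable]: "(\<lambda>d. d) \<in> borel_measurable \<mu>" by (rule measurable_mu_borel) simp
  have "{d \<in> space \<mu>. d < x} \<in> sets \<mu>" "{d \<in> space \<mu>. x \<le> d} \<in> sets \<mu>" by measurable
  then show "{d \<in> types. d < x} \<in> sets \<mu>" "{d \<in> types. x \<le> d} \<in> sets \<mu>" by (simp_all add: space_mu)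
qed

lemma below_mono: "x \<le> y \<Longrightarrow> below x \<le> below y"
  unfolding below_def by (rule finite_measure_mono) auto

lemma below_nonneg: "0 \<le> below x"
  by (simp add: below_def)

lemma below_le_mass: "below x \<le> mass"
  using bounded_measure[of "{d \<in> types. d < x}"] by (simp add: below_def mass_def space_mu)

lemma below_zero: "below 0 = 0"
proof -
  have "{d \<in> types. d < 0} = {}" by (auto simp: types_def)
  then show ?thesis by (simp only: below_def measure_empty)
qed

lemma measure_ge: "measure \<mu> {d \<in> types. x \<le> d} = mass - below x"
proof -
  have "types - {d \<in> types. d < x} = {d \<in> types. x \<le> d}" by auto
  then show ?thesis using finite_measure_compl[of "{d \<in> types. d < x}"]
    by (simp add: space_mu below_def mass_def)
qed

lemma finite_avail [simp]: "finite (avail t d)"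
  by (simp add: avail_def)

lemma consumer_strategies_eq: "consumer_strategies n t d = insert None (Some ` avail t d)"
  by (auto simp: consumer_strategies_def avail_def)

lemma sum_choices: "(\<Sum>k\<in>choices n. f k) = f None + (\<Sum>k<n. f (Some k))"
  unfolding choices_def by (subst sum.insert) (auto simp: sum.reindex)

section \<open>Mixed consumption and uniqueness of loads\<close>

context
  fixes t s
  assumes mix: "mixed_consumption_profile n \<mu> t s"
begin

lemma mixed_measurable:
  assumes "k < n"
  shows "(\<lambda>d. s d (Some k)) \<in> borel_measurable \<mu>"
proof -
  have k: "Some k \<in> choices n" using assms by (simp add: choices_def)
  have "(\<lambda>d. s d (Some k)) \<in> measurable \<mu> (restrict_space borel {0..1})"
    using measurable_compose[OF _ measurable_component_singleton[OF k]] mix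
    by (auto simp: mixed_consumption_profile_def)
  then show ?thesis by (simp add: measurable_restrict_space2_iff)
qed

lemma mixed_nonneg: "d \<in> types \<Longrightarrow> k < n \<Longrightarrow> 0 \<le> s d (Some k)"
  using mix by (auto simp: mixed_consumption_profile_def choices_def)

lemma mixed_sum_le:
  assumes "d \<in> types"
  shows "(\<Sum>k<n. s d (Some k)) \<le> 1"
proof -
  have "0 \<le> s d None" "s d None + (\<Sum>k<n. s d (Some k)) = 1"
    using mix assms by (auto simp: mixed_consumption_profile_def sum_choices[symmetric] choices_def)
  then show ?thesis by linarith
qed

lemma mixed_le_1:
  assumes "d \<in> types" "k < n"
  shows "s d (Some k) \<le> 1"
proof -
  have "s d (Some k) \<le> (\<Sum>k<n. s d (Some k))"
    by (rule member_le_sum) (use assms mixed_nonneg in auto)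
  then show ?thesis using mixed_sum_le[of d] assms by simp
qed

lemma mixed_avail:
  assumes "d \<in> types" "k < n" "s d (Some k) \<noteq> 0"
  shows "k \<in> avail t d"
proof -
  have "Some k \<in> mixed_supp n (s d)" using assms by (auto simp: mixed_supp_def choices_def)
  then show ?thesis using mix assms
    by (auto simp: mixed_consumption_profile_def consumer_strategies_eq)
qed

lemma mixed_integrable:
  assumes "k < n"
  shows "integrable \<mu> (\<lambda>d. s d (Some k))"
  by (rule integrable_const_bound[where B = 1])
    (use assms mixed_measurable mixed_nonneg mixed_le_1 in \<open>auto simp: space_mu abs_le_iff intro!: AE_I2 intro: order.trans[of _ 0]\<close>)

lemma sum_consumer_load:
  assumes "B \<subseteq> {..<n}"
  shows "(\<Sum>k\<in>B. c k * consumer_load \<mu> s (Some k)) = (LINT d|\<mu>. (\<Sum>k\<in>B. c k * s d (Some k)))"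
    and "integrable \<mu> (\<lambda>d. \<Sum>k\<in>B. c k * s d (Some k))"
  using assms mixed_integrable
  by (auto simp: consumer_load_def Bochner_Integration.integral_sum subset_iff
      intro!: Bochner_Integration.integrable_sum)

end

lemma equilibrium_mixed: "consumer_equilibrium n \<mu> t s \<Longrightarrow> mixed_consumption_profile n \<mu> t s"
  by (simp add: consumer_equilibrium_def)

context
  fixes t s
  assumes eq: "consumer_equilibrium n \<mu> t s"
begin

lemma equilibrium_sum:
  assumes "d \<in> types" "avail t d \<noteq> {}"
  shows "(\<Sum>k<n. s d (Some k)) = 1"
proof -
  have "None \<notin> mixed_supp n (s d)" using eq assms
    by (auto simp: consumer_equilibrium_def consumer_strategies_eq)
  then have "s d None = 0" by (auto simp: mixed_supp_def choices_def)
  moreover have "s d None + (\<Sum>k<n. s d (Some k)) = 1"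
    using eq assms by (auto simp: consumer_equilibrium_def mixed_consumption_profile_def sum_choices[symmetric])
  ultimately show ?thesis by simp
qed

lemma equilibrium_supp:
  assumes "d \<in> types" "k < n" "s d (Some k) \<noteq> 0" "j \<in> avail t d"
  shows "consumer_load \<mu> s (Some k) \<le> consumer_load \<mu> s (Some j)"
  using eq assms by (auto simp: consumer_equilibrium_def mixed_supp_def choices_def consumer_strategies_eq)

text \<open>Read the loads of \<open>s\<close> as prices: under \<open>s\<close> every type uses
  only its cheapest available producers, under \<open>s'\<close> it pays at least that price.
  Integrate over the types.\<close>

lemma equilibrium_cheapest:
  assumes s': "consumer_equilibrium n \<mu> t s'"
  defines "l \<equiv> \<lambda>k. consumer_load \<mu> s (Some k)"
  shows "(\<Sum>k<n. l k * l k) \<le> (\<Sum>k<n. l k * consumer_load \<mu> s' (Some k))"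
proof -
  note mix = equilibrium_mixed[OF s']
  have "(\<Sum>k<n. l k * s d (Some k)) \<le> (\<Sum>k<n. l k * s' d (Some k))" if d: "d \<in> types" for d
  proof (cases "avail t d = {}")
    case True
    then have "s d (Some k) = 0" "s' d (Some k) = 0" if "k < n" for k
      using mixed_avail[OF mix d that] mixed_avail[OF equilibrium_mixed[OF eq] d that] by auto
    then show ?thesis by simp
  next
    case False
    define c where "c = Min (l ` avail t d)"
    have c: "c \<le> l j" if "j \<in> avail t d" for j using that by (simp add: c_def)
    have "c \<in> l ` avail t d" unfolding c_def by (rule Min_in) (use False in auto)
    then obtain i where i: "i \<in> avail t d" "c = l i" by auto
    have "(\<Sum>k<n. l k * s d (Some k)) \<le> (\<Sum>k<n. c * s d (Some k))"
    proof (rule sum_mono)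
      fix k assume k: "k \<in> {..<n}"
      show "l k * s d (Some k) \<le> c * s d (Some k)"
        using equilibrium_supp[OF d, of k i] k i mixed_nonneg[OF equilibrium_mixed[OF eq] d, of k]
        by (cases "s d (Some k) = 0") (auto simp: l_def intro!: mult_right_mono)
    qed
    also have "\<dots> = c" using equilibrium_sum[OF d False] by (simp add: sum_distrib_left[symmetric])
    also have "\<dots> = (\<Sum>k<n. c * s' d (Some k))"
      using market.equilibrium_sum[OF market_axioms s' d False] by (simp add: sum_distrib_left[symmetric])
    also have "\<dots> \<le> (\<Sum>k<n. l k * s' d (Some k))"
    proof (rule sum_mono)
      fix k assume k: "k \<in> {..<n}"
      show "c * s' d (Some k) \<le> l k * s' d (Some k)"
        using mixed_avail[OF mix d, of k] k c mixed_nonneg[OF mix d, of k]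
        by (cases "s' d (Some k) = 0") (auto intro!: mult_right_mono)
    qed
    finally show ?thesis .
  qed
  then have "(LINT d|\<mu>. (\<Sum>k<n. l k * s d (Some k))) \<le> (LINT d|\<mu>. (\<Sum>k<n. l k * s' d (Some k)))"
    by (intro integral_mono sum_consumer_load(2)[OF mix] sum_consumer_load(2)[OF equilibrium_mixed[OF eq]])
      (auto simp: space_mu)
  then show ?thesis
    unfolding l_def
    by (simp add: sum_consumer_load(1)[OF mix] sum_consumer_load(1)[OF equilibrium_mixed[OF eq]])
qed

end

text \<open>Each equilibrium strategy minimises the expected load it experiences, so
  \<open>\<Sum> (l\<^sub>k - l'\<^sub>k)\<^sup>2 \<le> 0\<close> for the loads of two equilibria.\<close>

lemma equilibrium_load_unique:
  assumes "consumer_equilibrium n \<mu> t s" "consumer_equilibrium n \<mu> t s'" "j < n"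
  shows "consumer_load \<mu> s (Some j) = consumer_load \<mu> s' (Some j)"
proof -
  let ?l = "\<lambda>k. consumer_load \<mu> s (Some k)" and ?m = "\<lambda>k. consumer_load \<mu> s' (Some k)"
  have "(\<Sum>k<n. (?l k - ?m k)\<^sup>2) = (\<Sum>k<n. ?l k * ?l k) - (\<Sum>k<n. ?l k * ?m k) +
      ((\<Sum>k<n. ?m k * ?m k) - (\<Sum>k<n. ?m k * ?l k))"
    by (simp add: power2_eq_square algebra_simps sum.distrib sum_subtractf sum_distrib_left)
  also have "\<dots> \<le> 0"
    using equilibrium_cheapest[OF assms(1,2)]
      equilibrium_cheapest[OF assms(2,1)] by simp
  finally have "(\<Sum>k<n. (?l k - ?m k)\<^sup>2) = 0" by (simp add: order.antisym sum_nonneg)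
  then show ?thesis using assms(3) by (simp add: sum_nonneg_eq_0_iff)
qed

section \<open>Existence of consumer equilibria\<close>

text \<open>The positions cut the types into finitely many pieces on which \<open>avail t\<close> is
  constant, each a finite intersection of intervals; \<open>n_pos\<close> excludes an intersection
  over no index.\<close>

lemma avail_measurable: "avail t \<in> measurable \<mu> (count_space (Pow {..<n}))"
proof -
  have "avail t -` {X} \<inter> space \<mu> \<in> sets \<mu>" if "X \<subseteq> {..<n}" for X
  proof -
    have "avail t -` {X} \<inter> space \<mu> =
        (\<Inter>j\<in>{..<n}. if j \<in> X then {d \<in> types. t j \<le> d} else {d \<in> types. d < t j})" (is "_ = ?I")
    proof (rule set_eqI)
      fix d
      have "avail t d = X \<longleftrightarrow> (\<forall>j<n. j \<in> X \<longleftrightarrow> t j \<le> d)"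
        using that by (auto simp: avail_def)
      moreover have "d \<in> ?I \<longleftrightarrow> (\<forall>j<n. d \<in> types \<and> (j \<in> X \<longleftrightarrow> t j \<le> d))"
      proof -
        have "d \<in> (if j \<in> X then {d \<in> types. t j \<le> d} else {d \<in> types. d < t j}) \<longleftrightarrow>
            d \<in> types \<and> (j \<in> X \<longleftrightarrow> t j \<le> d)" for j by auto
        then show ?thesis by (simp only: INT_iff lessThan_iff Ball_def)
      qed
      moreover have "0 < n" using n_pos by simp
      ultimately show "d \<in> avail t -` {X} \<inter> space \<mu> \<longleftrightarrow> d \<in> ?I"
        by (auto simp only: space_mu vimage_eq singleton_iff Int_iff)
    qed
    also have "\<dots> \<in> sets \<mu>"
    proof (rule sets.finite_INT)
      show "{..<n} \<noteq> {}" using n_pos by (simp add: lessThan_empty_iff)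
    qed (simp_all add: sets_less sets_ge)
    finally show ?thesis .
  qed
  moreover have "avail t \<in> space \<mu> \<rightarrow> Pow {..<n}" by (auto simp: avail_def)
  ultimately show ?thesis by (simp add: measurable_count_space_eq2)
qed

text \<open>A type matters only through the set of producers it can reach. Grouping types by that
  set leaves finitely many weighted groups, and a balanced allocation of them is an
  equilibrium.\<close>

lemma equilibrium_exists: "\<exists>s. consumer_equilibrium n \<mu> t s"
proof -
  define G where "G = Pow {..<n} - {{}}"
  define w where "w X = measure \<mu> {d \<in> types. avail t d = X}" for X
  have avail_sets: "{d \<in> types. avail t d = X} \<in> sets \<mu>" if "X \<subseteq> {..<n}" for X
  proof -
    have "avail t -` {X} \<inter> space \<mu> \<in> sets \<mu>"
      by (rule measurable_sets[OF avail_measurable]) (use that in auto)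
    then show ?thesis by (simp add: space_mu vimage_def Int_def conj_commute)
  qed
  obtain a where a: "\<And>X j. a X j \<in> {0..1::real}" "\<And>X. X \<in> G \<Longrightarrow> (\<Sum>j\<in>X. a X j) = 1"
    "\<And>X j. j \<notin> X \<Longrightarrow> a X j = 0"
    "\<And>X j k. X \<in> G \<Longrightarrow> j \<in> X \<Longrightarrow> k \<in> X \<Longrightarrow> a X k \<noteq> 0 \<Longrightarrow>
       (\<Sum>Y\<in>G. w Y * a Y k) \<le> (\<Sum>Y\<in>G. w Y * a Y j)"
    using balanced_allocation[of "{..<n}" G w] by (auto simp: G_def w_def)
  \<comment> \<open>The restriction to \<open>choices n\<close> makes \<open>s d\<close>
    extensional, as the product space requires. Types that reach nobody, left out of
    \<open>G\<close>, choose \<open>None\<close>.\<close>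
  define s :: mixed_consumption where "s d = (\<lambda>c\<in>choices n. case c of
      None \<Rightarrow> if avail t d = {} then 1 else 0 | Some j \<Rightarrow> a (avail t d) j)" for d
  have s_Some: "s d (Some j) = a (avail t d) j" if "j < n" for d j
    using that by (simp add: s_def choices_def)
  have s_None: "s d None = (if avail t d = {} then 1 else 0)" for d
    by (simp add: s_def choices_def)
  have avail_G: "avail t d \<in> G" if "avail t d \<noteq> {}" for d
    using that by (auto simp: G_def avail_def)
  have load_eq: "consumer_load \<mu> s (Some j) = (\<Sum>X\<in>G. w X * a X j)" if "j < n" for j
  proof -
    have "consumer_load \<mu> s (Some j) = (LINT d|\<mu>. (\<Sum>X\<in>G. a X j * indicator {d \<in> types. avail t d = X} d))"
      unfolding consumer_load_def
    proof (rule Bochner_Integration.integral_cong[OF refl])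
      fix d assume d: "d \<in> space \<mu>"
      have "(\<Sum>X\<in>G. a X j * indicator {d \<in> types. avail t d = X} d) = (\<Sum>X\<in>G. if X = avail t d then a X j else 0)"
        by (rule sum.cong) (use d in \<open>auto simp: space_mu indicator_def\<close>)
      \<comment> \<open>For a type reaching nobody both sides are \<open>0\<close>:
        \<open>{}\<close> is not in \<open>G\<close>, and \<open>a {} j = 0\<close>.\<close>
      also have "\<dots> = a (avail t d) j"
        using avail_G[of d] a(3)[of j "{}"] by (auto simp: G_def)
      finally show "s d (Some j) = (\<Sum>X\<in>G. a X j * indicator {d \<in> types. avail t d = X} d)"
        using that by (simp add: s_Some)
    qed
    also have "\<dots> = (\<Sum>X\<in>G. a X j * w X)"
    proof (subst Bochner_Integration.integral_sum)
      fix X assume "X \<in> G"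
      then have "{d \<in> types. avail t d = X} \<in> sets \<mu>" by (intro avail_sets) (auto simp: G_def)
      then show "integrable \<mu> (\<lambda>d. a X j * indicator {d \<in> types. avail t d = X} d)"
        by (intro integrable_mult_right integrable_real_indicator) (auto simp: emeasure_eq_measure)
    next
      show "(\<Sum>X\<in>G. (LINT d|\<mu>. a X j * indicator {d \<in> types. avail t d = X} d)) = (\<Sum>X\<in>G. a X j * w X)"
        by (rule sum.cong) (auto simp: w_def space_mu Int_absorb2 Collect_conj_eq)
    qed
    finally show ?thesis by (simp add: mult.commute)
  qed
  have "mixed_consumption_profile n \<mu> t s"
    unfolding mixed_consumption_profile_def
  proof (intro conjI ballI)
    show "s \<in> measurable \<mu> (Pi\<^sub>M (choices n) (\<lambda>_. restrict_space borel {0..1}))"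
      unfolding s_def
    proof (rule measurable_restrict)
      fix c assume "c \<in> choices n"
      have "(\<lambda>X. case c of None \<Rightarrow> if X = {} then 1 else 0 | Some j \<Rightarrow> a X j) \<in>
          measurable (count_space (Pow {..<n})) (restrict_space borel {0..1::real})"
        using a(1) by (auto simp: space_restrict_space split: option.split)
      from measurable_compose[OF avail_measurable this]
      show "(\<lambda>d. case c of None \<Rightarrow> if avail t d = {} then 1 else 0 | Some j \<Rightarrow> a (avail t d) j) \<in>
          measurable \<mu> (restrict_space borel {0..1})" .
    qed
  next
    fix d k assume "d \<in> types" "k \<in> choices n"
    then show "0 \<le> s d k" using a(1) by (auto simp: choices_def s_None s_Some)
  next
    fix d assume d: "d \<in> types"
    have "(\<Sum>k<n. s d (Some k)) = (\<Sum>k<n. a (avail t d) k)" by (simp add: s_Some)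
    also have "\<dots> = (\<Sum>k\<in>avail t d. a (avail t d) k)"
      by (rule sum.mono_neutral_right) (use a(3) in \<open>auto simp: avail_def\<close>)
    finally show "(\<Sum>k\<in>choices n. s d k) = 1"
      using a(2)[OF avail_G, of d] by (auto simp: sum_choices s_None)
    show "mixed_supp n (s d) \<subseteq> consumer_strategies n t d"
      using a(3)[of _ "avail t d"] by (auto simp: mixed_supp_def consumer_strategies_eq choices_def s_Some s_None image_iff split: if_splits)
  qed
  moreover have "None \<in> mixed_supp n (s d) \<longrightarrow> consumer_strategies n t d = {None}" for d
    by (auto simp: mixed_supp_def s_None consumer_strategies_eq)
  moreover have "consumer_load \<mu> s k \<le> consumer_load \<mu> s j"
    if "d \<in> types" "k \<in> mixed_supp n (s d)" "j \<in> consumer_strategies n t d - {None}" for d k j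
  proof -
    note prems = that
    obtain j' where j: "j = Some j'" "j' \<in> avail t d" using prems(3) by (auto simp: consumer_strategies_eq)
    then have ne: "avail t d \<noteq> {}" "j' < n" by (auto simp: avail_def)
    obtain k' where k: "k = Some k'" "k' < n" "a (avail t d) k' \<noteq> 0"
      using prems(2) ne by (auto simp: mixed_supp_def choices_def s_None s_Some split: if_splits)
    show ?thesis
      using a(4)[OF avail_G[OF ne(1)] j(2) _ k(3)] a(3) k j ne load_eq by auto
  qed
  ultimately show ?thesis unfolding consumer_equilibrium_def by blast
qed

section \<open>Bounds on producer loads\<close>

lemma producer_load_eq:
  assumes "consumer_equilibrium n \<mu> t s" "j < n"
  shows "load t j = consumer_load \<mu> s (Some j)"
  unfolding producer_load_def
  by (rule the_equality) (use assms equilibrium_load_unique in blast)+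

lemma load_nonneg:
  assumes "j < n"
  shows "0 \<le> load t j"
proof -
  obtain s where s: "consumer_equilibrium n \<mu> t s" using equilibrium_exists by blast
  show ?thesis unfolding producer_load_eq[OF s assms] consumer_load_def
    by (rule integral_nonneg_AE) (use mixed_nonneg[OF equilibrium_mixed[OF s] _ assms] in \<open>auto simp: space_mu\<close>)
qed

text \<open>Whoever reaches \<open>j\<close> also reaches \<open>i\<close>; if \<open>j\<close> had
  the larger load, nobody would choose it and its load would be \<open>0\<close>.\<close>

lemma load_antimono:
  assumes "i < n" "j < n" "t i \<le> t j"
  shows "load t j \<le> load t i"
proof (rule ccontr)
  assume less: "\<not> ?thesis"
  obtain s where s: "consumer_equilibrium n \<mu> t s" using equilibrium_exists by blast
  have "s d (Some j) = 0" if "d \<in> types" for d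
  proof (rule ccontr)
    assume nz: "s d (Some j) \<noteq> 0"
    have "i \<in> avail t d"
      using mixed_avail[OF equilibrium_mixed[OF s] that assms(2) nz] assms by (auto simp: avail_def)
    from equilibrium_supp[OF s that assms(2) nz this] less show False
      by (simp add: producer_load_eq[OF s] assms)
  qed
  then have "load t j = (LINT d|\<mu>. 0)" unfolding producer_load_eq[OF s assms(2)] consumer_load_def
    by (intro Bochner_Integration.integral_cong) (auto simp: space_mu)
  then show False using less load_nonneg[OF assms(1), of t] by simp
qed

text \<open>Producers in \<open>B\<close> sell only to types from \<open>y\<close> upwards, each
  contributing total probability at most \<open>1\<close>.\<close>

lemma sum_load_le:
  assumes "B \<subseteq> {..<n}" "\<And>i. i \<in> B \<Longrightarrow> y \<le> t i"
  shows "(\<Sum>i\<in>B. load t i) \<le> mass - below y"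
proof -
  obtain s where s: "consumer_equilibrium n \<mu> t s" using equilibrium_exists by blast
  note mix = equilibrium_mixed[OF s]
  have "(\<Sum>i\<in>B. load t i) = (\<Sum>i\<in>B. 1 * consumer_load \<mu> s (Some i))"
    by (rule sum.cong) (use assms(1) in \<open>auto simp: producer_load_eq[OF s]\<close>)
  also have "\<dots> = (LINT d|\<mu>. (\<Sum>i\<in>B. 1 * s d (Some i)))"
    by (rule sum_consumer_load(1)[OF mix assms(1)])
  also have "\<dots> \<le> (LINT d|\<mu>. indicator {d \<in> types. y \<le> d} d)"
  proof (rule integral_mono[OF sum_consumer_load(2)[OF mix assms(1)]])
    show "integrable \<mu> (indicator {d \<in> types. y \<le> d} :: real \<Rightarrow> real)"
      by (rule integrable_real_indicator) (auto simp: emeasure_eq_measure)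
    fix d assume "d \<in> space \<mu>"
    then have d: "d \<in> types" by (simp add: space_mu)
    show "(\<Sum>i\<in>B. 1 * s d (Some i)) \<le> indicator {d \<in> types. y \<le> d} d"
    proof (cases "y \<le> d")
      case True
      have "(\<Sum>i\<in>B. s d (Some i)) \<le> (\<Sum>i<n. s d (Some i))"
        by (rule sum_mono2) (use assms(1) mixed_nonneg[OF mix d] in auto)
      also have "\<dots> \<le> 1" by (rule mixed_sum_le[OF mix d])
      finally show ?thesis using True d by simp
    next
      case False
      have "s d (Some i) = 0" if "i \<in> B" for i
        using mixed_avail[OF mix d, of i] assms(1) assms(2)[OF that] that False by (force simp: avail_def)
      then show ?thesis by simp
    qed
  qed
  also have "\<dots> = mass - below y" by (simp add: space_mu Int_absorb2 Collect_conj_eq flip: measure_ge)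
  finally show ?thesis .
qed

text \<open>Types from \<open>t i\<close> upwards can use \<open>i\<close>, hence never a producer
  with a strictly larger load: all their demand stays within \<open>C\<close>.\<close>

lemma sum_load_ge:
  assumes "C \<subseteq> {..<n}" "i \<in> C" "\<And>k. k < n \<Longrightarrow> k \<notin> C \<Longrightarrow> load t i < load t k"
  shows "mass - below (t i) \<le> (\<Sum>i\<in>C. load t i)"
proof -
  obtain s where s: "consumer_equilibrium n \<mu> t s" using equilibrium_exists by blast
  note mix = equilibrium_mixed[OF s]
  have i: "i < n" using assms by auto
  have "mass - below (t i) = (LINT d|\<mu>. indicator {d \<in> types. t i \<le> d} d)"
    by (simp add: space_mu Int_absorb2 Collect_conj_eq flip: measure_ge)
  also have "\<dots> \<le> (LINT d|\<mu>. (\<Sum>k\<in>C. 1 * s d (Some k)))"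
  proof (rule integral_mono[OF _ sum_consumer_load(2)[OF mix assms(1)]])
    show "integrable \<mu> (indicator {d \<in> types. t i \<le> d} :: real \<Rightarrow> real)"
      by (rule integrable_real_indicator) (auto simp: emeasure_eq_measure)
    fix d assume "d \<in> space \<mu>"
    then have d: "d \<in> types" by (simp add: space_mu)
    show "indicator {d \<in> types. t i \<le> d} d \<le> (\<Sum>k\<in>C. 1 * s d (Some k))"
    proof (cases "t i \<le> d")
      case True
      then have av: "i \<in> avail t d" using i by (simp add: avail_def)
      have "s d (Some k) = 0" if "k < n" "k \<notin> C" for k
        using equilibrium_supp[OF s d that(1) _ av] assms(3)[OF that] that i
        by (force simp: producer_load_eq[OF s])
      then have "(\<Sum>k<n. s d (Some k)) = (\<Sum>k\<in>C. s d (Some k))"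
        by (intro sum.mono_neutral_right) (use assms(1) in auto)
      then show ?thesis using equilibrium_sum[OF s d] av True d by force
    next
      case False
      then show ?thesis using assms(1) mixed_nonneg[OF mix d] by (auto intro!: sum_nonneg)
    qed
  qed
  also have "\<dots> = (\<Sum>i\<in>C. 1 * consumer_load \<mu> s (Some i))"
    by (rule sum_consumer_load(1)[OF mix assms(1), symmetric])
  also have "\<dots> = (\<Sum>i\<in>C. load t i)"
    by (rule sum.cong) (use assms(1) in \<open>auto simp: producer_load_eq[OF s]\<close>)
  finally show ?thesis .
qed

text \<open>A producer at \<open>0\<close> is open to everybody, so the whole mass is shared by
  those producers, at most \<open>n\<close>, whose load does not exceed that of
  \<open>j\<close>.\<close>

lemma fair_le_load_at_zero:
  assumes "j < n" "t j = 0"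
  shows "fair \<le> load t j"
proof -
  define C where "C = {i. i < n \<and> load t i \<le> load t j}"
  have "mass \<le> (\<Sum>i\<in>C. load t i)"
    using sum_load_ge[of C j t] assms by (auto simp: C_def below_zero)
  also have "\<dots> \<le> real (card C) * load t j"
    using sum_bounded_above[of C "load t" "load t j"] by (simp add: C_def)
  also have "\<dots> \<le> real n * load t j"
    using card_mono[of "{..<n}" C] load_nonneg[OF assms(1)] by (intro mult_right_mono) (auto simp: C_def)
  finally have "real n * fair \<le> real n * load t j" by (simp only: n_fair)
  then show ?thesis using n_pos by simp
qed

section \<open>Filled levels and the fair load\<close>

definition low_count :: "profile \<Rightarrow> nat \<Rightarrow> nat" where
  "low_count t k = card {j. j < n \<and> below (t j) \<le> real k * fair}"

definition filled_from :: "nat \<Rightarrow> profile \<Rightarrow> bool" where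
  "filled_from m t \<longleftrightarrow> (\<forall>k. m \<le> k \<and> k < n \<longrightarrow> k < low_count t k)"

text \<open>Level \<open>m\<close> is tight, so losing one producer would unfill it, and
  \<open>t j\<close> is the highest position inside it: \<open>j\<close> cannot rise without
  breaking the level.\<close>

definition settled :: "profile \<Rightarrow> nat \<Rightarrow> bool" where
  "settled t j \<longleftrightarrow> (\<exists>m<n. below (t j) \<le> real m * fair \<and>
     (\<forall>y\<in>types. t j < y \<longrightarrow> real m * fair < below y) \<and> low_count t m = Suc m)"

text \<open>One indicator is added on each side so that no truncated subtraction occurs.\<close>

lemma low_count_update:
  assumes "j < n"
  shows "low_count (t(j := x)) k + (if below (t j) \<le> real k * fair then 1 else 0) =
    low_count t k + (if below x \<le> real k * fair then 1 else 0)"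
proof -
  define S where "S = {i. i < n \<and> i \<noteq> j \<and> below (t i) \<le> real k * fair}"
  have S: "finite S" "j \<notin> S" by (auto simp: S_def)
  have "low_count u k = card S + (if below (u j) \<le> real k * fair then 1 else 0)"
    if "\<And>i. i \<noteq> j \<Longrightarrow> u i = t i" for u
  proof -
    have "i \<in> S \<longleftrightarrow> i < n \<and> i \<noteq> j \<and> below (u i) \<le> real k * fair" for i
      using that[of i] by (auto simp: S_def)
    then have "{i. i < n \<and> below (u i) \<le> real k * fair} =
        (if below (u j) \<le> real k * fair then insert j S else S)"
      using assms by auto
    then show ?thesis using S by (simp add: low_count_def)
  qed
  from this[of t] this[of "t(j := x)"] show ?thesis by simp
qed

lemma low_count_le: "low_count t k \<le> n"
  unfolding low_count_def using card_mono[of "{..<n}" "{j. j < n \<and> below (t j) \<le> real k * fair}"] by auto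

lemma low_member:
  assumes "C \<subseteq> {..<n}" "n < low_count t k + card C"
  obtains i where "i \<in> C" "below (t i) \<le> real k * fair"
proof -
  let ?L = "{j. j < n \<and> below (t j) \<le> real k * fair}"
  have "?L \<inter> C \<noteq> {}"
  proof
    assume "?L \<inter> C = {}"
    then have "card (?L \<union> C) = low_count t k + card C"
      using finite_subset[OF assms(1)] by (simp add: card_Un_disjoint low_count_def)
    moreover have "card (?L \<union> C) \<le> n" using card_mono[of "{..<n}" "?L \<union> C"] assms(1) by auto
    ultimately show False using assms(2) by simp
  qed
  then show ?thesis using that by auto
qed

text \<open>Otherwise, by pigeonhole, some member of \<open>C\<close> lies within level
  \<open>n - card C\<close>. The types that reach it, of mass at least \<open>card C * fair\<close>,
  buy inside \<open>C\<close>, yet all loads there are below \<open>fair\<close>.\<close>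

lemma underloaded_excess:
  assumes "i < n" "load t i < fair"
  defines "C \<equiv> {i. i < n \<and> load t i < fair}"
  shows "low_count t (n - card C) \<le> n - card C"
proof (rule ccontr)
  assume less: "\<not> ?thesis"
  have cC: "card C \<le> n" using card_mono[of "{..<n}" C] by (auto simp: C_def)
  obtain y where y: "y \<in> C" "below (t y) \<le> real (n - card C) * fair"
    by (rule low_member[of C t "n - card C"]) (use less cC in \<open>auto simp: C_def\<close>)
  have "real (card C) * fair \<le> mass - below (t y)"
    using y(2) cC by (simp add: of_nat_diff algebra_simps flip: n_fair)
  also have "\<dots> \<le> (\<Sum>i\<in>C. load t i)"
    by (rule sum_load_ge) (use y in \<open>auto simp: C_def\<close>)
  also have "\<dots> < (\<Sum>i\<in>C. fair)"
    by (rule sum_strict_mono) (use y in \<open>auto simp: C_def\<close>)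
  finally show False by simp
qed

text \<open>An underloaded producer would entail an unfilled level, so all loads are at least
  \<open>fair\<close>; their total is at most \<open>n * fair\<close>.\<close>

lemma filled_fair:
  assumes "filled_from 0 t" "j < n"
  shows "load t j = fair"
proof -
  have ge: "fair \<le> load t i" if "i < n" for i
  proof (rule ccontr)
    assume u: "\<not> ?thesis"
    let ?C = "{i. i < n \<and> load t i < fair}"
    have "card ?C > 0" using u that by (auto simp: card_gt_0_iff)
    then have "n - card ?C < n" using n_pos by simp
    then show False using underloaded_excess[OF that, of t] u assms(1) by (auto simp: filled_from_def)
  qed
  have "(\<Sum>i<n. load t i) \<le> mass - below (Min (t ` {..<n}))"
    by (rule sum_load_le) auto
  then have "(\<Sum>i<n. load t i - fair) \<le> 0"
    using below_nonneg[of "Min (t ` {..<n})"] by (simp add: sum_subtractf n_fair)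
  moreover have "load t j - fair \<le> (\<Sum>i<n. load t i - fair)"
    by (rule member_le_sum) (use assms ge in auto)
  ultimately show ?thesis using ge[OF assms(2)] by simp
qed

text \<open>If level \<open>m\<close> is not filled, the producers \<open>B\<close> above it are too
  many to all earn \<open>fair\<close>. The underloaded ones \<open>C\<close> lie in
  \<open>B\<close> and absorb at least \<open>(n - m - 1) * fair\<close>; with the load of
  \<open>j\<close> this exceeds what \<open>B\<close> can get.\<close>

lemma filled_above_threshold:
  assumes "filled_from (Suc m) t" "m < n" "j < n" "fair \<le> load t j" "real m * fair < below (t j)"
  shows "m < low_count t m"
proof (rule ccontr)
  assume few: "\<not> ?thesis"
  define B where "B = {i. i < n \<and> real m * fair < below (t i)}"
  define C where "C = {i. i < n \<and> load t i < fair}"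
  have sub: "B \<subseteq> {..<n}" "C \<subseteq> {..<n}" by (auto simp: B_def C_def)
  then have fin: "finite B" "finite C" using finite_subset by auto
  have jB: "j \<in> B" using assms by (simp add: B_def)
  have "{..<n} - B = {j. j < n \<and> below (t j) \<le> real m * fair}" by (auto simp: B_def)
  then have "low_count t m = n - card B"
    using card_Diff_subset[of B "{..<n}"] fin sub by (simp add: low_count_def)
  then have cB: "n - m \<le> card B" using few by simp
  define b where "b = Min (t ` B)"
  have "b \<in> t ` B" unfolding b_def by (rule Min_in) (use fin jB in auto)
  then have "real m * fair < below b" by (auto simp: B_def)
  moreover have "(\<Sum>i\<in>B. load t i) \<le> mass - below b"
    by (rule sum_load_le) (use sub fin in \<open>auto simp: b_def\<close>)
  \<comment> \<open>Strict, because the lowest position \<open>b\<close> in \<open>B\<close> lies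
    strictly above level \<open>m\<close>.\<close>
  ultimately have sB: "(\<Sum>i\<in>B. load t i) < real (n - m) * fair"
    using assms(2) by (simp add: of_nat_diff algebra_simps flip: n_fair)
  have "C \<noteq> {}"
  proof
    assume "C = {}"
    then have "fair \<le> load t i" if "i < n" for i using that by (auto simp: C_def not_less[symmetric])
    then have "real (card B) * fair \<le> (\<Sum>i\<in>B. load t i)"
      by (intro sum_bounded_below) (simp add: B_def)
    moreover have "real (n - m) * fair \<le> real (card B) * fair"
      using cB fair_pos by (simp add: of_nat_le_iff del: of_nat_diff)
    ultimately show False using sB by simp
  qed
  then obtain i where i: "i \<in> C" by blast
  have cC: "0 < card C" "card C \<le> n"
    using i fin card_mono[of "{..<n}" C] sub by (auto simp: card_gt_0_iff)
  have "low_count t (n - card C) \<le> n - card C"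
    using underloaded_excess[of i t] i by (auto simp: C_def)
  then have "\<not> (Suc m \<le> n - card C \<and> n - card C < n)" using assms(1) by (auto simp: filled_from_def)
  \<comment> \<open>Level \<open>n - card C\<close> is not filled, so it must be at most
    \<open>m\<close>.\<close>
  then have big: "n - m \<le> card C" using cC assms(2) by linarith
  \<comment> \<open>Level \<open>Suc m\<close> contains an underloaded producer: by pigeonhole if
    \<open>Suc m < n\<close>, and because level \<open>n\<close> holds everybody if
    \<open>Suc m = n\<close>.\<close>
  obtain y where y: "y \<in> C" "below (t y) \<le> real (Suc m) * fair"
  proof (cases "Suc m < n")
    case True
    then have "Suc m < low_count t (Suc m)" using assms(1) by (auto simp: filled_from_def)
    then have "n < low_count t (Suc m) + card C" using big by linarith
    then show ?thesis using low_member[OF sub(2)] that by blast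
  next
    case False
    then have "n = Suc m" using assms(2) by simp
    then show ?thesis using that[OF i] below_le_mass[of "t i"] by (simp flip: n_fair)
  qed
  have "mass - below (t y) \<le> (\<Sum>i\<in>C. load t i)"
    by (rule sum_load_ge) (use y sub in \<open>auto simp: C_def\<close>)
  \<comment> \<open>By \<open>load_antimono\<close> underloaded producers sit above
    \<open>j\<close>, hence in \<open>B\<close>.\<close>
  moreover have "(\<Sum>i\<in>insert j C. load t i) \<le> (\<Sum>i\<in>B. load t i)"
  proof (rule sum_mono2)
    have "i \<in> B" if "i \<in> C" for i
    proof -
      have "t j \<le> t i"
        using load_antimono[of i j t] that assms(3,4) by (force simp: C_def)
      then show ?thesis using below_mono[of "t j" "t i"] assms(5) that by (auto simp: B_def C_def)
    qed
    then show "insert j C \<subseteq> B" using jB by auto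
  qed (use fin sub load_nonneg in auto)
  moreover have "j \<notin> C" using assms(4) by (simp add: C_def)
  ultimately have "mass - below (t y) + fair \<le> (\<Sum>i\<in>B. load t i)"
    using assms(4) fin by simp
  then show False using sB y(2) assms(2) by (simp add: of_nat_diff algebra_simps flip: n_fair)
qed

section \<open>Best responses of a single producer\<close>

context
  fixes t :: profile and j :: nat and x :: real
  assumes j: "j < n" and br: "fine_best_response n \<mu> j t x"
begin

lemma best_response_fair: "fair \<le> load (t(j := x)) j"
proof -
  have "0 \<in> types" by (simp add: types_def)
  then have "load (t(j := 0)) j \<le> load (t(j := x)) j"
    using br by (auto simp: fine_best_response_def fine_prefers_def not_less)
  then show ?thesis using fair_le_load_at_zero[OF j, of "t(j := 0)"] by simp
qed

lemma best_response_low_count: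
  assumes "filled_from (Suc m) (t(j := x))" "m < n" "real m * fair < below x"
  shows "m < low_count (t(j := x)) m"
  using filled_above_threshold[OF assms(1,2) j best_response_fair] assms(3) by simp

lemma low_count_mono:
  assumes "below x \<le> real m * fair"
  shows "low_count t m \<le> low_count (t(j := x)) m"
  using low_count_update[OF j, of t x m] assms by (auto split: if_splits)

text \<open>Descending induction on the level. A mover ending inside level \<open>k\<close> cannot
  lower its count; one ending above it earns at least \<open>fair\<close>, so
  \<open>filled_above_threshold\<close> applies.\<close>

lemma best_response_filled:
  assumes "filled_from m t"
  shows "filled_from m (t(j := x))"
proof -
  have "filled_from m (t(j := x))" if "m \<le> n"
    using that
  proof (induction rule: inc_induct)
    case base
    show ?case by (simp add: filled_from_def)
  next
    case (step k)
    have "k < low_count (t(j := x)) k"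
    proof (cases "below x \<le> real k * fair")
      case True
      then show ?thesis using low_count_mono[OF True] assms step.hyps
        by (meson filled_from_def less_le_trans)
    next
      case False
      then show ?thesis using best_response_low_count[OF step.IH step.hyps(2)] by simp
    qed
    then show ?case using step.IH unfolding filled_from_def by (metis Suc_leI le_neq_implies_less)
  qed
  then show ?thesis by (cases "m \<le> n") (auto simp: filled_from_def)
qed

text \<open>One producer suffices to fill level \<open>0\<close>: the mover itself, or one supplied
  by \<open>filled_above_threshold\<close>.\<close>

lemma best_response_filled_0:
  assumes "filled_from (Suc 0) t"
  shows "filled_from 0 (t(j := x))"
proof -
  have f: "filled_from (Suc 0) (t(j := x))" by (rule best_response_filled[OF assms])
  have "0 < low_count (t(j := x)) 0"
  proof (cases "below x \<le> 0")
    case True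
    then show ?thesis using j by (auto simp: low_count_def card_gt_0_iff)
  next
    case False
    then show ?thesis using best_response_low_count[OF f] n_pos by simp
  qed
  then show ?thesis using f unfolding filled_from_def by (metis Suc_leI gr0I)
qed

text \<open>Take the lowest tight level containing the mover. If it could climb inside this level,
  all levels would stay filled, and it would earn the same load \<open>fair\<close> at a higher
  position, which fine preferences favour.\<close>

lemma best_response_settled:
  assumes f: "filled_from 0 (t(j := x))"
  shows "settled (t(j := x)) j"
proof -
  let ?t = "t(j := x)"
  define Q where "Q m \<longleftrightarrow> m < n \<and> below x \<le> real m * fair \<and> low_count ?t m = Suc m" for m
  \<comment> \<open>Level \<open>n - 1\<close> qualifies: being filled, it holds all
    \<open>n\<close> producers.\<close>
  have "Q (n - 1)"
  proof -
    have c: "low_count ?t (n - 1) = n"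
    proof (rule antisym[OF low_count_le])
      have "n - 1 < low_count ?t (n - 1)" using f n_pos by (simp add: filled_from_def)
      then show "n \<le> low_count ?t (n - 1)" by simp
    qed
    then have "{i. i < n \<and> below (?t i) \<le> real (n - 1) * fair} = {..<n}"
      by (intro card_subset_eq) (auto simp: low_count_def)
    then have "below (?t j) \<le> real (n - 1) * fair" using j by blast
    then show ?thesis using c n_pos by (simp add: Q_def)
  qed
  define m where "m = (LEAST m. Q m)"
  have m: "Q m" unfolding m_def by (rule LeastI[of Q, OF \<open>Q (n - 1)\<close>])
  have min: "\<not> Q k" if "k < m" for k using that not_less_Least[of k Q] by (simp add: m_def)
  have "real m * fair < below y" if y: "y \<in> types" "x < y" for y
  proof (rule ccontr)
    assume low: "\<not> ?thesis"
    have "filled_from 0 (t(j := y))" unfolding filled_from_def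
    proof (intro allI impI)
      fix k assume k: "0 \<le> k \<and> k < n"
      have upd: "low_count (t(j := y)) k + (if below x \<le> real k * fair then 1 else 0) =
          low_count ?t k + (if below y \<le> real k * fair then 1 else 0)"
        using low_count_update[OF j, of ?t y k] by simp
      have c: "k < low_count ?t k" using f k by (simp add: filled_from_def)
      show "k < low_count (t(j := y)) k"
      proof (cases "k < m")
        case True
        \<comment> \<open>By minimality of \<open>m\<close>, a smaller level containing
          \<open>x\<close> has a producer to spare and survives the loss of
          \<open>j\<close>.\<close>
        then have "below x \<le> real k * fair \<longrightarrow> low_count ?t k \<noteq> Suc k"
          using min[OF True] k by (auto simp: Q_def)
        then show ?thesis using upd c by (auto split: if_splits)
      next
        case False
        then have "real m * fair \<le> real k * fair" using fair_pos by simp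
        then have "below y \<le> real k * fair" using low by linarith
        then show ?thesis using upd c by (auto split: if_splits)
      qed
    qed
    then have "load (t(j := y)) j = load ?t j" using filled_fair f j by simp
    then show False using br y by (auto simp: fine_best_response_def fine_prefers_def)
  qed
  then show ?thesis using m by (auto simp: settled_def Q_def)
qed

text \<open>Leaving the tight level would unfill it, so \<open>x\<close> stays inside and is at most
  \<open>t j\<close>; anything lower earns the same load \<open>fair\<close> and is worse.\<close>

lemma settled_best_response_eq:
  assumes "filled_from 0 t" "settled t j" "t j \<in> types"
  shows "x = t j"
proof -
  have f: "filled_from 0 (t(j := x))" by (rule best_response_filled[OF assms(1)])
  obtain m where m: "m < n" "below (t j) \<le> real m * fair" "low_count t m = Suc m"
      "\<And>y. y \<in> types \<Longrightarrow> t j < y \<Longrightarrow> real m * fair < below y"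
    using assms(2) by (auto simp: settled_def)
  have "m < low_count (t(j := x)) m" using f m by (simp add: filled_from_def)
  then have "below x \<le> real m * fair"
    using low_count_update[OF j, of t x m] m by (auto split: if_splits)
  moreover have x: "x \<in> types" using br by (simp add: fine_best_response_def)
  ultimately have "x \<le> t j" using m(4)[of x] by force
  moreover have "\<not> x < t j"
    using br assms(3) filled_fair[OF f j] filled_fair[OF assms(1) j]
    by (auto simp: fine_best_response_def fine_prefers_def)
  ultimately show ?thesis by simp
qed

lemma settled_preserved:
  assumes f: "filled_from 0 t" and i: "settled t i" "i < n" "t i \<in> types" "t j \<in> types"
  shows "settled (t(j := x)) i"
proof (cases "i = j")
  case True
  then show ?thesis using best_response_settled best_response_filled[OF f] by simp
next
  case False
  let ?t = "t(j := x)"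
  have f': "filled_from 0 ?t" by (rule best_response_filled[OF f])
  obtain m where m: "m < n" "below (t i) \<le> real m * fair" "low_count t m = Suc m"
      "\<And>y. y \<in> types \<Longrightarrow> t i < y \<Longrightarrow> real m * fair < below y"
    using i by (auto simp: settled_def)
  obtain k where k: "k < n" "below x \<le> real k * fair" "low_count ?t k = Suc k"
      "\<And>y. y \<in> types \<Longrightarrow> x < y \<Longrightarrow> real k * fair < below y"
    using best_response_settled[OF f'] by (auto simp: settled_def)
  have "low_count ?t m = Suc m"
  proof (rule ccontr)
    assume ne: "low_count ?t m \<noteq> Suc m"
    have "m < low_count ?t m" using f' m by (simp add: filled_from_def)
    \<comment> \<open>The level stays filled, so its count can only have changed by \<open>j\<close>
      entering from above.\<close>
    then have *: "real m * fair < below (t j)" "below x \<le> real m * fair"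
      using low_count_update[OF j, of t x m] m(3) ne by (auto split: if_splits)
    then have "x < t j" using below_mono[of "t j" x] by force
    \<comment> \<open>After the move \<open>j\<close> is settled at a tight level \<open>k\<close>,
      and its old position lay above it. So before the move level \<open>k\<close> held only
      \<open>k\<close> producers and was not filled.\<close>
    then have "real k * fair < below (t j)" using k(4) i(4) by blast
    then have "low_count t k = k" using low_count_update[OF j, of t x k] k by simp
    then show False using f k by (auto simp: filled_from_def)
  qed
  then show ?thesis using m False by (auto simp: settled_def)
qed

end

end

section \<open>Schedules and greedy rounds\<close>

lemma schedule_covers:
  assumes "schedule n P"
  shows "\<exists>e\<ge>a. (\<Union>i\<in>{a..e}. P i) = {..<n}"
proof -
  have "\<forall>j\<in>{..<n}. \<exists>i\<ge>a. j \<in> P i"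
    using assms by (auto simp: schedule_def infinite_nat_iff_unbounded_le)
  then obtain f where f: "\<And>j. j < n \<Longrightarrow> a \<le> f j \<and> j \<in> P (f j)"
    by (metis lessThan_iff)
  define e where "e = Max (insert a (f ` {..<n}))"
  have e: "a \<le> e" "\<And>j. j < n \<Longrightarrow> f j \<le> e" by (auto simp: e_def)
  have "(\<Union>i\<in>{a..e}. P i) = {..<n}"
    using assms f e by (fastforce simp: schedule_def)
  then show ?thesis using e(1) by blast
qed

text \<open>\<open>round_end n P r\<close> is the first index after \<open>r\<close> greedily chosen consecutive rounds
  starting at \<open>0\<close>.\<close>

fun round_end :: "nat \<Rightarrow> (nat \<Rightarrow> nat set) \<Rightarrow> nat \<Rightarrow> nat" where
  "round_end n P 0 = 0"
| "round_end n P (Suc r) =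
     Suc (LEAST e. round_end n P r \<le> e \<and> (\<Union>i\<in>{round_end n P r..e}. P i) = {..<n})"

declare round_end.simps(2) [simp del]

context
  fixes n P
  assumes sched: "schedule n P"
begin

lemma round_end_less: "round_end n P r < round_end n P (Suc r)"
  and round_end_covers: "(\<Union>i\<in>{round_end n P r..<round_end n P (Suc r)}. P i) = {..<n}"
proof -
  let ?Q = "\<lambda>e. round_end n P r \<le> e \<and> (\<Union>i\<in>{round_end n P r..e}. P i) = {..<n}"
  have "?Q (LEAST e. ?Q e)"
    using schedule_covers[OF sched, of "round_end n P r"] by (metis (mono_tags, lifting) LeastI)
  then show "round_end n P r < round_end n P (Suc r)"
    "(\<Union>i\<in>{round_end n P r..<round_end n P (Suc r)}. P i) = {..<n}"
    by (auto simp: round_end.simps(2) atLeastLessThanSuc_atLeastAtMost)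
qed

lemma round_end_least:
  assumes "round_end n P r \<le> e" "(\<Union>i\<in>{round_end n P r..e}. P i) = {..<n}"
  shows "round_end n P (Suc r) \<le> Suc e"
  unfolding round_end.simps(2) by (intro Suc_le_mono[THEN iffD2] Least_le conjI assms)

lemma round_end_mono: "r \<le> r' \<Longrightarrow> round_end n P r \<le> round_end n P r'"
  by (rule lift_Suc_mono_le[of "round_end n P"]) (use round_end_less less_imp_le in blast)+

text \<open>The greedy round in progress at the first index of \<open>R\<close> began no later than
  \<open>R\<close> and ends as early as possible, so its last index
  \<open>round_end n P (Suc r) - 1\<close> is not after the end of \<open>R\<close>.\<close>

lemma round_contains_round_end:
  assumes "is_round n P R"
  obtains r where "round_end n P (Suc r) - 1 \<in> R"
proof -
  obtain a b where ab: "a \<le> b" "R = {a..b}" and cov: "(\<Union>i\<in>R. P i) = {..<n}"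
    using assms by (auto simp: is_round_def)
  have sm: "strict_mono (round_end n P)" by (rule strict_mono_Suc_iff[THEN iffD2]) (use round_end_less in blast)
  have ex: "\<exists>r. a < round_end n P (Suc r)"
    using strict_mono_imp_increasing[OF sm, of "Suc a"] by (metis Suc_le_eq)
  define r where "r = (LEAST r. a < round_end n P (Suc r))"
  have r: "a < round_end n P (Suc r)" unfolding r_def by (rule LeastI_ex[OF ex])
  have r': "round_end n P r \<le> a"
  proof (cases r)
    case (Suc q)
    then have "\<not> a < round_end n P (Suc q)" using not_less_Least[of q "\<lambda>r. a < round_end n P (Suc r)"] by (simp add: r_def)
    then show ?thesis using Suc by simp
  qed simp
  have "(\<Union>i\<in>{round_end n P r..b}. P i) = {..<n}"
  proof
    show "(\<Union>i\<in>{round_end n P r..b}. P i) \<subseteq> {..<n}" using sched by (auto simp: schedule_def)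
    show "{..<n} \<subseteq> (\<Union>i\<in>{round_end n P r..b}. P i)" unfolding cov[symmetric] ab(2) using r' by (intro UN_mono) auto
  qed
  then have "round_end n P (Suc r) \<le> Suc b" using round_end_least r' ab by simp
  then have "round_end n P (Suc r) - 1 \<in> {a..b}"
    using r unfolding atLeastAtMost_iff by arith
  then show ?thesis using that ab(2) by blast
qed

text \<open>Disjoint rounds contain last indices of different greedy rounds, so it suffices to count
  the greedy rounds ending early enough.\<close>

lemma card_disjoint_rounds:
  assumes "disjoint_rounds n P 0 (round_end n P q) F"
  shows "card F \<le> q - 1"
proof -
  have rd: "is_round n P R" "R \<subseteq> {i. i + 2 \<le> round_end n P q}" if "R \<in> F" for R
    using assms that by (auto simp: disjoint_rounds_def)
  have dj: "disjoint F" using assms by (simp add: disjoint_rounds_def)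
  have "\<exists>r. round_end n P (Suc r) - 1 \<in> R" if "R \<in> F" for R
    using round_contains_round_end[OF rd(1)[OF that]] by blast
  then obtain f where f: "\<And>R. R \<in> F \<Longrightarrow> round_end n P (Suc (f R)) - 1 \<in> R"
    by metis
  have "inj_on f F"
  proof (rule inj_onI)
    fix R S assume "R \<in> F" "S \<in> F" "f R = f S"
    then show "R = S" using f[of R] f[of S] dj by (auto simp: disjoint_def)
  qed
  moreover have "f ` F \<subseteq> {..<q - 1}"
  proof safe
    fix R assume "R \<in> F"
    \<comment> \<open>The \<open>q\<close>-th greedy round ends at
      \<open>round_end n P q - 1\<close>, one index too late; hence \<open>q - 1\<close> and not
      \<open>q\<close>.\<close>
    then have "round_end n P (Suc (f R)) - 1 + 2 \<le> round_end n P q" using f rd(2) by blast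
    then have "\<not> q \<le> Suc (f R)" using round_end_mono[of q "Suc (f R)"] by linarith
    then show "f R < q - 1" by simp
  qed
  ultimately show ?thesis using card_inj_on_le[of f F "{..<q - 1}"] by simp
qed

lemma reached_round_end:
  assumes "0 < q"
  shows "\<exists>r. reached_in_rounds n P 0 (round_end n P q) r \<and> r \<le> q"
proof -
  let ?A = "card ` {F. disjoint_rounds n P 0 (round_end n P q) F}"
  have "?A \<subseteq> {..q - 1}" using card_disjoint_rounds by auto
  moreover have "disjoint_rounds n P 0 (round_end n P q) {}" by (simp add: disjoint_rounds_def)
  ultimately have "Max ?A \<le> q - 1"
    using finite_subset[of ?A "{..q - 1}"] by (subst Max_le_iff) auto
  then show ?thesis using assms by (auto simp: reached_in_rounds_def)
qed

end

section \<open>Filled levels and settled producers along the dynamic\<close>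

context market
begin

context
  fixes t :: "nat \<Rightarrow> profile" and P :: "nat \<Rightarrow> nat set"
  assumes dyn: "best_response_dynamic n \<mu> t P" and seq: "sequential P"
begin

lemma dynamic_schedule: "schedule n P"
  using dyn by (simp add: best_response_dynamic_def)

lemma dynamic_types: "j < n \<Longrightarrow> t i j \<in> types"
  using dyn by (auto simp: best_response_dynamic_def profiles_def PiE_iff)

lemma dynamic_step:
  obtains j x where "P i = {j}" "j < n" "fine_best_response n \<mu> j (t i) x"
    "t (Suc i) = (t i)(j := x)"
proof -
  obtain j where j: "P i = {j}" using seq card_1_singletonE by (metis sequential_def)
  moreover have "j < n" using j dynamic_schedule by (auto simp: schedule_def)
  moreover have "fine_best_response n \<mu> j (t i) (t (Suc i) j)"
    using dyn j by (simp add: best_response_dynamic_def)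
  moreover have "t (Suc i) = (t i)(j := t (Suc i) j)"
  proof
    fix k
    \<comment> \<open>Profiles are extensional, so coordinates outside \<open>{..<n}\<close> never
      change.\<close>
    have out: "t m k = undefined" if "\<not> k < n" for m
      using dyn that by (auto simp: best_response_dynamic_def profiles_def PiE_iff extensional_def)
    show "t (Suc i) k = ((t i)(j := t (Suc i) j)) k"
      using dyn j out by (cases "k < n") (auto simp: best_response_dynamic_def)
  qed
  ultimately show ?thesis by (rule that)
qed

lemma dynamic_filled:
  assumes "filled_from m (t i)" "i \<le> k"
  shows "filled_from m (t k)"
  using assms(2)
proof (induction rule: dec_induct)
  case (step k)
  obtain j x where j: "j < n" "fine_best_response n \<mu> j (t k) x"
      "t (Suc k) = (t k)(j := x)"
    by (rule dynamic_step[of k])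
  show ?case by (subst j(3)) (rule best_response_filled[OF j(1,2) step.IH])
qed (rule assms(1))

text \<open>During a round starting in a profile filled from \<open>m + 1\<close> on, either level \<open>m\<close> is filled
  by some move or every mover goes below that level.\<close>

lemma round_fills_level:
  assumes f: "filled_from (Suc m) (t a)" and m: "m < n"
    and cov: "(\<Union>i\<in>{a..<b}. P i) = {..<n}" and ab: "a \<le> b"
  shows "filled_from m (t b)"
proof -
  have f': "filled_from (Suc m) (t k)" if "a \<le> k" for k by (rule dynamic_filled[OF f that])
  have inv: "m < low_count (t k) m \<or> (\<forall>j\<in>\<Union>i\<in>{a..<k}. P i. below (t k j) \<le> real m * fair)"
    if "a \<le> k" for k
    using that
  proof (induction rule: dec_induct)
    case (step k)
    obtain j x where j: "P k = {j}" "j < n" "fine_best_response n \<mu> j (t k) x"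
        "t (Suc k) = (t k)(j := x)"
      by (rule dynamic_step[of k])
    show ?case
    proof (cases "below x \<le> real m * fair")
      case low: True
      have mono: "low_count (t k) m \<le> low_count (t (Suc k)) m"
        using low_count_mono[OF j(2,3) low] j(4) by simp
      show ?thesis
      proof (cases "m < low_count (t k) m")
        case True
        then show ?thesis using mono by linarith
      next
        case False
        then have IH: "\<forall>i\<in>\<Union>i\<in>{a..<k}. P i. below (t k i) \<le> real m * fair" using step.IH by blast
        have "below (t (Suc k) i) \<le> real m * fair" if i: "l \<in> {a..<Suc k}" "i \<in> P l" for i l
        proof (cases "i = j")
          case False
          then have "l \<noteq> k" using i(2) j(1) by blast
          then have "l \<in> {a..<k}" using i(1) by (simp add: less_Suc_eq)
          then have "below (t k i) \<le> real m * fair" using IH i(2) by blast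
          moreover have "t (Suc k) i = t k i" using False by (subst j(4)) simp
          ultimately show ?thesis by (simp only:)
        qed (use low j(4) in simp)
        then show ?thesis by blast
      qed
    next
      case False
      have "filled_from (Suc m) ((t k)(j := x))"
        using f'[of "Suc k"] step.hyps j(4) by simp
      then have "m < low_count ((t k)(j := x)) m"
        using best_response_low_count[OF j(2,3)] m False by simp
      then show ?thesis unfolding j(4) by (rule disjI1)
    qed
  qed simp
  \<comment> \<open>By the end of the round everybody has moved, so the second alternative puts all
    \<open>n\<close> producers inside level \<open>m\<close>.\<close>
  have "m < low_count (t b) m"
  proof (cases "m < low_count (t b) m")
    case False
    then have "\<forall>j<n. below (t b j) \<le> real m * fair" using inv[OF ab] unfolding cov by simp
    then have "{j. j < n \<and> below (t b j) \<le> real m * fair} = {..<n}" by auto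
    then show ?thesis using m by (simp add: low_count_def)
  qed
  then show ?thesis using f'[OF ab] unfolding filled_from_def by (metis Suc_leI le_neq_implies_less)
qed

text \<open>\<open>filled_from n\<close> is vacuous at the start, and each greedy round gains one
  level.\<close>

lemma filled_after_rounds:
  "r < n \<Longrightarrow> filled_from (n - r) (t (round_end n P r))"
proof (induction r)
  case 0
  show ?case by (simp add: filled_from_def)
next
  case (Suc r)
  have "Suc (n - Suc r) = n - r" using Suc by simp
  then show ?case
    using round_fills_level[of "n - Suc r", OF _ _ round_end_covers[OF dynamic_schedule]
        less_imp_le[OF round_end_less[OF dynamic_schedule]]] Suc by simp
qed

text \<open>The first move of the \<open>n\<close>-th greedy round completes the filling. Every
  mover of that round becomes settled and remains so while others move, and the round reaches
  everybody.\<close>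

lemma settled_after_rounds:
  assumes "j < n"
  shows "settled (t (round_end n P n)) j" "filled_from 0 (t (round_end n P n))"
proof -
  define a where "a = round_end n P (n - 1)"
  have Suc: "Suc (n - 1) = n" using n_pos by simp
  have a: "a < round_end n P n" "(\<Union>i\<in>{a..<round_end n P n}. P i) = {..<n}"
    using round_end_less[OF dynamic_schedule, of "n - 1"]
      round_end_covers[OF dynamic_schedule, of "n - 1"] unfolding Suc a_def .
  have f1: "filled_from (Suc 0) (t a)"
    using filled_after_rounds[of "n - 1"] n_pos by (simp add: a_def)
  have f0: "filled_from 0 (t k)" if "a < k" for k
  proof -
    obtain j x where j: "j < n" "fine_best_response n \<mu> j (t a) x"
        "t (Suc a) = (t a)(j := x)"
      by (rule dynamic_step[of a])
    have "filled_from 0 (t (Suc a))" by (subst j(3)) (rule best_response_filled_0[OF j(1,2) f1])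
    then show ?thesis by (rule dynamic_filled) (use that in simp)
  qed
  have "\<forall>i\<in>\<Union>l\<in>{a..<k}. P l. settled (t k) i" if "a \<le> k" for k
    using that
  proof (induction rule: dec_induct)
    case (step k)
    obtain j x where j: "P k = {j}" "j < n" "fine_best_response n \<mu> j (t k) x"
        "t (Suc k) = (t k)(j := x)"
      by (rule dynamic_step[of k])
    show ?case
    proof
      fix i assume i: "i \<in> (\<Union>l\<in>{a..<Suc k}. P l)"
      then have "i < n" using dynamic_schedule by (auto simp: schedule_def)
      show "settled (t (Suc k)) i"
      proof (cases "i = j")
        case True
        have "filled_from 0 ((t k)(j := x))" using f0[of "Suc k"] step.hyps j(4) by simp
        from best_response_settled[OF j(2,3) this] show ?thesis using True j(4) by simp
      next
        case False
        obtain l where l: "l \<in> {a..<Suc k}" "i \<in> P l" using i by blast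
        then have "l \<noteq> k" using False j(1) by blast
        then have l': "l \<in> {a..<k}" using l(1) by (simp add: less_Suc_eq)
        then have i': "settled (t k) i" using step.IH l(2) by blast
        \<comment> \<open>A move of this round precedes step \<open>k\<close>, so \<open>t k\<close>
          is already filled; for \<open>t a\<close> this is not known.\<close>
        have "a < k" using l' by simp
        show ?thesis unfolding j(4)
          by (rule settled_preserved[OF j(2,3) f0[OF \<open>a < k\<close>] i' \<open>i < n\<close>])
            (rule dynamic_types[OF \<open>i < n\<close>], rule dynamic_types[OF j(2)])
      qed
    qed
  qed simp
  from this[OF less_imp_le[OF a(1)]] show "settled (t (round_end n P n)) j"
    unfolding a(2) using assms by blast
  show "filled_from 0 (t (round_end n P n))" by (rule f0[OF a(1)])
qed

text \<open>Settled producers never move, so the profile is frozen. Each producer is scheduled again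
  later, and the best response it then plays is its frozen position.\<close>

lemma nash_after_rounds:
  assumes "round_end n P n \<le> k"
  shows "fine_nash_equilibrium n \<mu> (t k)"
proof -
  let ?e = "round_end n P n"
  have const: "t i = t ?e" if "?e \<le> i" for i
    using that
  proof (induction rule: dec_induct)
    case (step i)
    obtain j x where j: "j < n" "fine_best_response n \<mu> j (t i) x"
        "t (Suc i) = (t i)(j := x)"
      by (rule dynamic_step[of i])
    have "x = t i j"
      by (rule settled_best_response_eq[OF j(1,2) _ _ dynamic_types[OF j(1)]])
        (simp_all only: step.IH settled_after_rounds[OF j(1)])
    then have "t (Suc i) = t i" unfolding j(3) by (simp only: fun_upd_triv)
    then show ?case using step.IH by (rule trans)
  qed simp
  have "fine_best_response n \<mu> j (t k) (t k j)" if "j < n" for j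
  proof -
    have "infinite {i. j \<in> P i}" using dynamic_schedule that by (simp add: schedule_def)
    from this[unfolded infinite_nat_iff_unbounded_le, rule_format, of ?e]
    obtain i where i: "?e \<le> i" "j \<in> P i" by auto
    then have "fine_best_response n \<mu> j (t i) (t (Suc i) j)"
      using dyn by (simp add: best_response_dynamic_def)
    then show ?thesis using const[OF i(1)] const[OF assms] const[OF le_SucI[OF i(1)]] by (simp only:)
  qed
  moreover have "t k \<in> profiles n" using dyn by (simp add: best_response_dynamic_def)
  ultimately show ?thesis by (simp add: fine_nash_equilibrium_def)
qed

end

end

theorem corollary4p38:
  fixes n :: nat and \<mu> :: "real measure"
    and t :: "nat \<Rightarrow> profile" and P :: "nat \<Rightarrow> nat set"
  assumes "n \<ge> 1"
    and "finite_measure \<mu>"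
    and "sets \<mu> = sets (restrict_space borel types)"
    and "measure \<mu> types > 0"
    and "best_response_dynamic n \<mu> t P"
    and "sequential P"
  shows "\<exists>i r. reached_in_rounds n P 0 i r \<and> r \<le> n \<and>
           (\<forall>k\<ge>i. fine_nash_equilibrium n \<mu> (t k))"
proof -
  interpret market \<mu> n
    using assms by (intro market.intro market_axioms.intro)
  have "schedule n P" using assms(5) by (simp add: best_response_dynamic_def)
  then obtain r where "reached_in_rounds n P 0 (round_end n P n) r" "r \<le> n"
    using reached_round_end[of n P n] assms(1) by auto
  then show ?thesis using nash_after_rounds[OF assms(5,6)] by blast
qed

end
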